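(* Let $G$ be a finite simple undirected connected graph with $n\ge 2$ vertices and $m$ edges, let $q$ be the largest eigenvalue of its signless Laplacian, and let $\gamma=\frac{qn}{4m}$. Then $$\gamma\le\frac{n^2}{4(n-1)}.$$ This bound is exact (i.e. equality holds) for star graphs $K_{1,n-1}$, which have $q=n$.
   Context: The signless Laplacian of $G$ is the matrix $D+A$, where $A$ is the adjacency matrix of $G$ and $D$ is the diagonal matrix of vertex degrees. The quantity $\gamma=\frac{q}{2d}=\frac{qn}{4m}$, where $d=2m/n$ is the average degree, is a spectral measure of the irregularity of $G$, defined for graphs with at least one edge. *)

theory Defs
  imports "Graph_Theory.Graph_Theory" "Jordan_Normal_Form.Spectral_Radius"
begin

text \<open>
  A finite simple undirected graph is a \<^locale>\<open>graph\<close> of the Graph Theory library: a finite,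
  symmetric, loop-free digraph without multiple arcs. Each undirected edge is thus represented
  by two opposite arcs, so the out-degree of a vertex is its degree, while edges have to be
  counted as unordered pairs of end points.
\<close>

definition num_edges :: "('a, 'b) pre_digraph \<Rightarrow> nat" where
  "num_edges G = card ((\<lambda>e. {tail G e, head G e}) ` arcs G)"

text \<open>
  Matrices have index set \<open>{0..<n}\<close>, so the matrices of a graph are taken with respect to an
  enumeration \<open>vs\<close> of its vertices (a distinct list with \<open>set vs = verts G\<close>). Different
  enumerations give permutation-similar matrices.
\<close>

definition adjacency_mat :: "'a list \<Rightarrow> ('a, 'b) pre_digraph \<Rightarrow> real mat" where
  "adjacency_mat vs G =
     mat (length vs) (length vs) (\<lambda>(i, j). if vs ! i \<rightarrow>\<^bsub>G\<^esub> vs ! j then 1 else 0)"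

definition degree_mat :: "'a list \<Rightarrow> ('a, 'b) pre_digraph \<Rightarrow> real mat" where
  "degree_mat vs G = mat_diag (length vs) (\<lambda>i. real (out_degree G (vs ! i)))"

definition signless_laplacian :: "'a list \<Rightarrow> ('a, 'b) pre_digraph \<Rightarrow> real mat" where
  "signless_laplacian vs G = degree_mat vs G + adjacency_mat vs G"

text \<open>
  The signless Laplacian is real symmetric, so all its eigenvalues are real, and there are
  finitely many and (for a nonempty vertex set) at least one of them; the maximum is proper.
\<close>

definition largest_eigenvalue :: "real mat \<Rightarrow> real" where
  "largest_eigenvalue A = Max (spectrum A)"

definition sl_index :: "'a list \<Rightarrow> ('a, 'b) pre_digraph \<Rightarrow> real" where
  "sl_index vs G = largest_eigenvalue (signless_laplacian vs G)"

definition irregularity :: "'a list \<Rightarrow> ('a, 'b) pre_digraph \<Rightarrow> real" where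
  "irregularity vs G =
     sl_index vs G * real (card (verts G)) / (4 * real (num_edges G))"

end

theory Submission
  imports Defs
begin

text \<open>
  Write \<open>d v\<close> for the degree of \<open>v\<close> and \<open>s v\<close> for the sum of the degrees of its neighbours. If
  \<open>f\<close> is an eigenvector for \<open>q\<close> and \<open>v\<close> maximises \<open>\<bar>f v\<bar> / d v\<close>, the eigenvalue equation at \<open>v\<close>
  gives \<open>q * d v \<le> (d v)\<^sup>2 + s v\<close>. Connectedness makes every degree positive, so
  \<open>s v \<le> 2 * m - (n - 1)\<close>; also \<open>s v \<le> d v * (n - 1)\<close> and \<open>m \<ge> n - 1\<close>. These three bounds yield
  \<open>q * (n - 1) \<le> m * n\<close>, which is the claim. For a star, \<open>n\<close> is an eigenvalue with eigenvector
  \<open>(n - 1, 1, \<dots>, 1)\<close>, and \<open>m = n - 1\<close> turns the upper bound into \<open>q \<le> n\<close>.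
\<close>

section \<open>Real symmetric matrices: eigenvalues are real and exist\<close>

text \<open>The Hermitian form \<open>h\<close> of \<open>A\<close> at an eigenvector
  \<open>w\<close> equals \<open>k\<close> times the squared norm \<open>r\<close>. Symmetry of
  \<open>A\<close> makes \<open>h\<close> equal to its own conjugate, and \<open>r\<close> is
  nonzero, so \<open>k\<close> is fixed by conjugation.\<close>

lemma symmetric_mat_eigenvalue_real:
  fixes A :: "real mat"
  assumes A: "A \<in> carrier_mat n n"
    and sym: "\<And>i j. i < n \<Longrightarrow> j < n \<Longrightarrow> A $$ (i, j) = A $$ (j, i)"
    and ev: "eigenvalue (map_mat complex_of_real A) k"
  shows "k \<in> \<real>"
proof -
  obtain w where w: "w \<in> carrier_vec n" "w \<noteq> 0\<^sub>v n"
    and eq: "map_mat complex_of_real A *\<^sub>v w = k \<cdot>\<^sub>v w"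
    using ev A unfolding eigenvalue_def eigenvector_def by auto
  have row: "(\<Sum>j<n. complex_of_real (A $$ (i, j)) * w $ j) = k * w $ i" if "i < n" for i
  proof -
    have "(map_mat complex_of_real A *\<^sub>v w) $ i = (\<Sum>j<n. complex_of_real (A $$ (i, j)) * w $ j)"
      using that A w(1) by (simp add: scalar_prod_def atLeast0LessThan)
    then show ?thesis using eq that w(1) by simp
  qed
  define h where "h = (\<Sum>i<n. \<Sum>j<n. cnj (w $ i) * (complex_of_real (A $$ (i, j)) * w $ j))"
  define r where "r = (\<Sum>i<n. (cmod (w $ i))\<^sup>2)"
  have "h = (\<Sum>i<n. cnj (w $ i) * (k * w $ i))"
    unfolding h_def by (intro sum.cong refl) (simp add: sum_distrib_left [symmetric] row)
  also have "\<dots> = k * complex_of_real r"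
    unfolding r_def of_real_sum sum_distrib_left
    by (intro sum.cong refl) (simp only: complex_norm_square ac_simps)
  finally have h: "h = k * complex_of_real r" .
  have "cnj h = (\<Sum>i<n. \<Sum>j<n. w $ i * (complex_of_real (A $$ (i, j)) * cnj (w $ j)))"
    unfolding h_def by simp
  also have "\<dots> = (\<Sum>j<n. \<Sum>i<n. w $ i * (complex_of_real (A $$ (i, j)) * cnj (w $ j)))"
    by (rule sum.swap)
  also have "\<dots> = h"
    unfolding h_def by (intro sum.cong refl) (simp add: sym ac_simps)
  finally have "cnj h = h" .
  moreover have "r \<noteq> 0"
  proof
    assume "r = 0"
    then have "\<forall>i<n. w $ i = 0"
      unfolding r_def by (subst (asm) sum_nonneg_eq_0_iff) auto
    then show False using w by (metis eq_vecI carrier_vecD index_zero_vec)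
  qed
  ultimately have "cnj k = k" using h by simp
  then show ?thesis by (simp add: Reals_cnj_iff)
qed

text \<open>This makes the maximum in \<open>largest_eigenvalue\<close> a genuine eigenvalue. A
  complex eigenvalue always exists, and symmetry forces it to be real.\<close>

lemma symmetric_mat_spectrum_nonempty:
  fixes A :: "real mat"
  assumes A: "A \<in> carrier_mat n n" and "n > 0"
    and sym: "\<And>i j. i < n \<Longrightarrow> j < n \<Longrightarrow> A $$ (i, j) = A $$ (j, i)"
  shows "spectrum A \<noteq> {}"
proof -
  let ?B = "map_mat complex_of_real A"
  have B: "?B \<in> carrier_mat n n" using A by simp
  obtain k where k: "eigenvalue ?B k"
    using spectrum_non_empty[OF B \<open>n > 0\<close>] unfolding spectrum_def by auto
  then obtain a where a: "k = complex_of_real a"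
    using symmetric_mat_eigenvalue_real[OF A sym] by (auto elim: Reals_cases)
  \<comment> \<open>The characteristic polynomial of \<open>?B\<close> is that of \<open>A\<close>
    with its coefficients embedded in the complex numbers, so a real root descends to
    \<open>char_poly A\<close>.\<close>
  have "poly (map_poly complex_of_real (char_poly A)) (complex_of_real a) = 0"
    using k a eigenvalue_root_char_poly[OF B] of_real_hom.char_poly_hom[OF A] by metis
  then have "poly (char_poly A) a = 0"
    by (simp add: of_real_hom.poly_map_poly)
  then show ?thesis using eigenvalue_root_char_poly[OF A] unfolding spectrum_def by auto
qed

section \<open>Neighbourhoods, degrees and the handshake identity\<close>

definition neighbours :: "('a, 'b) pre_digraph \<Rightarrow> 'a \<Rightarrow> 'a set" where
  "neighbours G v = {u. v \<rightarrow>\<^bsub>G\<^esub> u}"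

lemma (in wf_digraph) neighbours_subset: "neighbours G v \<subseteq> verts G"
  unfolding neighbours_def by (auto dest: adj_in_verts)

lemma (in fin_digraph) finite_neighbours [simp]: "finite (neighbours G v)"
  using neighbours_subset finite_verts by (rule finite_subset)

lemma (in loopfree_digraph) not_in_neighbours: "v \<notin> neighbours G v"
  unfolding neighbours_def using adj_not_same by auto

text \<open>Without parallel arcs, an arc leaving \<open>v\<close> is determined by its
  head.\<close>

lemma (in nomulti_digraph) out_degree_eq_card_neighbours:
  "out_degree G v = card (neighbours G v)"
proof -
  have "neighbours G v = head G ` out_arcs G v"
    unfolding neighbours_def out_arcs_def arcs_ends_conv by auto
  moreover have "inj_on (head G) (out_arcs G v)"
    by (rule inj_onI) (auto simp: arc_to_ends_def intro: no_multi_arcs)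
  ultimately show ?thesis unfolding out_degree_def by (simp add: card_image)
qed

context graph
begin

text \<open>Each unordered edge arises from exactly two ordered pairs: both orientations occur by
  symmetry, and they differ because there are no loops.\<close>

lemma card_arcs_ends: "card (arcs_ends G) = 2 * num_edges G"
proof -
  let ?f = "\<lambda>(u :: 'a, v). {u, v}"
  have fin: "finite (arcs_ends G)" unfolding arcs_ends_def by simp
  have E: "(\<lambda>e. {tail G e, head G e}) ` arcs G = ?f ` arcs_ends G"
    unfolding arcs_ends_conv by (simp add: image_image)
  have fibre: "card {p \<in> arcs_ends G. ?f p = e} = 2" if e: "e \<in> ?f ` arcs_ends G" for e
  proof -
    obtain u v where uv: "u \<rightarrow>\<^bsub>G\<^esub> v" "e = {u, v}" using e by auto
    then have "u \<noteq> v" and "v \<rightarrow>\<^bsub>G\<^esub> u" using adj_not_same graph_symmetric by auto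
    have "{p \<in> arcs_ends G. ?f p = e} = {(u, v), (v, u)}"
    proof (rule Set.set_eqI)
      fix p
      show "p \<in> {p \<in> arcs_ends G. ?f p = e} \<longleftrightarrow> p \<in> {(u, v), (v, u)}"
        using uv \<open>v \<rightarrow>\<^bsub>G\<^esub> u\<close> by (cases p) (simp add: doubleton_eq_iff, blast)
    qed
    then show ?thesis using \<open>u \<noteq> v\<close> by simp
  qed
  have "card (arcs_ends G) = (\<Sum>e\<in>?f ` arcs_ends G. card {p \<in> arcs_ends G. ?f p = e})"
    using sum.image_gen[OF fin, of "\<lambda>_. 1::nat" ?f] by simp
  also have "\<dots> = 2 * card (?f ` arcs_ends G)" using fibre by simp
  finally show ?thesis unfolding num_edges_def E .
qed

lemma handshake: "(\<Sum>v\<in>verts G. out_degree G v) = 2 * num_edges G"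
proof -
  have "(SIGMA v:verts G. neighbours G v) = arcs_ends G"
    unfolding neighbours_def by (auto dest: adj_in_verts)
  then show ?thesis
    using card_SigmaI[of "verts G" "neighbours G"]
    by (simp add: card_arcs_ends out_degree_eq_card_neighbours)
qed

lemma out_degree_less: assumes "v \<in> verts G" shows "out_degree G v < card (verts G)"
proof -
  have "neighbours G v \<subset> verts G" using neighbours_subset not_in_neighbours assms by blast
  then show ?thesis
    by (simp add: out_degree_eq_card_neighbours psubset_card_mono)
qed

section \<open>Consequences of connectedness: positive degrees, edge count, neighbour
  degrees\<close>

text \<open>A nonempty set that no arc leaves contains everything reachable from it, hence all
  vertices, since a symmetric connected digraph is strongly connected.\<close>

lemma connected_crossing_arc:
  assumes "connected G" "S \<subseteq> verts G" "S \<noteq> {}" "S \<noteq> verts G"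
  obtains u v where "u \<in> S" "v \<in> verts G - S" "u \<rightarrow>\<^bsub>G\<^esub> v"
proof (rule ccontr)
  assume "\<not> thesis"
  with that have closed: "\<And>u v. u \<in> S \<Longrightarrow> u \<rightarrow>\<^bsub>G\<^esub> v \<Longrightarrow> v \<in> S"
    using adj_in_verts by blast
  obtain a b where ab: "a \<in> S" "b \<in> verts G" "b \<notin> S" using assms by auto
  have "a \<rightarrow>\<^sup>*\<^bsub>G\<^esub> b"
    using symmetric_connected_imp_strongly_connected[OF sym_arcs assms(1)] ab assms(2)
    by (auto simp: strongly_connected_def)
  then have "b \<in> S" by (induction rule: reachable_induct) (use ab closed in auto)
  then show False using ab by simp
qed

lemma connected_out_degree_pos:
  assumes "connected G" "card (verts G) \<ge> 2" "v \<in> verts G"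
  shows "out_degree G v > 0"
proof -
  have "{v} \<noteq> verts G" using assms(2) by (metis card_1_singleton_iff One_nat_def Suc_1 not_less_eq_eq order_refl)
  then obtain u where "v \<rightarrow>\<^bsub>G\<^esub> u"
    using connected_crossing_arc[of "{v}"] assms by auto
  then have "neighbours G v \<noteq> {}" unfolding neighbours_def by auto
  then show ?thesis by (simp add: out_degree_eq_card_neighbours card_gt_0_iff)
qed

text \<open>A spanning tree is grown one vertex at a time.\<close>

lemma connected_num_edges_ge:
  assumes conn: "connected G"
  shows "card (verts G) \<le> num_edges G + 1"
proof -
  define E where "E = (\<lambda>e. {tail G e, head G e}) ` arcs G"
  have "finite E" unfolding E_def by simp
  \<comment> \<open>The tree itself is not recorded: it is enough that \<open>Suc k\<close> suitable
    vertices span at least \<open>k\<close> edges.\<close>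
  have grow: "\<exists>S\<subseteq>verts G. card S = Suc k \<and> k \<le> card {e \<in> E. e \<subseteq> S}" if "Suc k \<le> card (verts G)" for k
    using that
  proof (induction k)
    case 0
    then obtain v where "v \<in> verts G" by fastforce
    then show ?case by (intro exI[of _ "{v}"]) auto
  next
    case (Suc k)
    then obtain S where S: "S \<subseteq> verts G" "card S = Suc k" "k \<le> card {e \<in> E. e \<subseteq> S}" by auto
    then have "S \<noteq> {}" "S \<noteq> verts G" using Suc.prems by auto
    with conn S obtain u v where uv: "u \<in> S" "v \<in> verts G - S" "u \<rightarrow>\<^bsub>G\<^esub> v"
      using connected_crossing_arc by metis
    then have new: "{u, v} \<in> E" unfolding E_def by force
    have finS: "finite S" using S finite_verts finite_subset by blast
    \<comment> \<open>The crossing edge is new because \<open>v\<close> lies outside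
      \<open>S\<close>.\<close>
    have "Suc k \<le> card (insert {u, v} {e \<in> E. e \<subseteq> S})"
      using S uv \<open>finite E\<close> by simp
    also have "\<dots> \<le> card {e \<in> E. e \<subseteq> insert v S}"
      using new uv \<open>finite E\<close> by (intro card_mono) auto
    finally show ?case using S uv finS by (intro exI[of _ "insert v S"]) auto
  qed
  show ?thesis
  proof (cases "card (verts G)")
    case (Suc k)
    then obtain S where "k \<le> card {e \<in> E. e \<subseteq> S}" using grow[of k] by auto
    also have "\<dots> \<le> card E" using \<open>finite E\<close> by (intro card_mono) auto
    finally show ?thesis using Suc unfolding num_edges_def E_def by simp
  qed simp
qed

text \<open>In the handshake sum, \<open>v\<close> contributes its degree \<open>d\<close>, and each
  of the \<open>n - 1 - d\<close> vertices that are neither \<open>v\<close> nor a neighbour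
  contributes at least 1. So at least \<open>n - 1\<close> of the total \<open>2 * m\<close> falls
  outside the neighbourhood.\<close>

lemma connected_sum_neighbour_degrees_le:
  assumes conn: "connected G" and n: "card (verts G) \<ge> 2" and v: "v \<in> verts G"
  shows "(\<Sum>u\<in>neighbours G v. out_degree G u) + card (verts G) \<le> 2 * num_edges G + 1"
proof -
  let ?d = "out_degree G"
  let ?R = "verts G - insert v (neighbours G v)"
  have "card ?R \<le> (\<Sum>u\<in>?R. ?d u)"
    using sum_mono[of ?R "\<lambda>_. 1" ?d] connected_out_degree_pos[OF conn n] by (force simp: Suc_le_eq)
  moreover have "2 * num_edges G = (\<Sum>u\<in>?R. ?d u) + (\<Sum>u\<in>insert v (neighbours G v). ?d u)"
    unfolding handshake[symmetric] using v neighbours_subset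
    by (intro sum.subset_diff) auto
  moreover have "(\<Sum>u\<in>insert v (neighbours G v). ?d u) = ?d v + (\<Sum>u\<in>neighbours G v. ?d u)"
    using not_in_neighbours by simp
  moreover have "card (verts G) = card ?R + Suc (?d v)"
  proof -
    have "card (insert v (neighbours G v)) \<le> card (verts G)"
      using v neighbours_subset by (intro card_mono) auto
    then show ?thesis
      using v neighbours_subset[of v] not_in_neighbours[of v]
      by (subst card_Diff_subset) (auto simp: out_degree_eq_card_neighbours)
  qed
  ultimately show ?thesis by linarith
qed

section \<open>The signless Laplacian as an operator on vertex functions\<close>

lemma signless_laplacian_carrier:
  "signless_laplacian vs G \<in> carrier_mat (length vs) (length vs)"
  unfolding signless_laplacian_def degree_mat_def adjacency_mat_def by simp

lemma signless_laplacian_mult_vec: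
  assumes vs: "distinct vs" "set vs = verts G" and i: "i < length vs"
  shows "(signless_laplacian vs G *\<^sub>v vec (length vs) (\<lambda>j. f (vs ! j))) $ i =
    real (out_degree G (vs ! i)) * f (vs ! i) + (\<Sum>u\<in>neighbours G (vs ! i). f u)"
proof -
  let ?v = "vs ! i" and ?N = "length vs"
  have entries: "(signless_laplacian vs G *\<^sub>v vec ?N (\<lambda>j. f (vs ! j))) $ i =
      (\<Sum>j<?N. signless_laplacian vs G $$ (i, j) * f (vs ! j))"
    using i signless_laplacian_carrier[of vs] by (simp add: scalar_prod_def atLeast0LessThan)
  have "(signless_laplacian vs G *\<^sub>v vec ?N (\<lambda>j. f (vs ! j))) $ i =
      (\<Sum>j<?N. (if i = j then real (out_degree G ?v) * f ?v else 0) +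
        (if ?v \<rightarrow>\<^bsub>G\<^esub> vs ! j then f (vs ! j) else 0))"
    unfolding entries using i
    by (intro sum.cong)
      (auto simp: signless_laplacian_def degree_mat_def adjacency_mat_def mat_diag_def algebra_simps)
  also have "\<dots> = real (out_degree G ?v) * f ?v + (\<Sum>j<?N. if ?v \<rightarrow>\<^bsub>G\<^esub> vs ! j then f (vs ! j) else 0)"
    using i by (simp add: sum.distrib)
  also have "(\<Sum>j<?N. if ?v \<rightarrow>\<^bsub>G\<^esub> vs ! j then f (vs ! j) else 0) =
      (\<Sum>u\<in>verts G. if ?v \<rightarrow>\<^bsub>G\<^esub> u then f u else 0)"
    using sum.reindex_bij_betw[OF bij_betw_nth[OF vs(1) refl refl],
        of "\<lambda>u. if ?v \<rightarrow>\<^bsub>G\<^esub> u then f u else 0"] vs(2) by simp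
  also have "\<dots> = (\<Sum>u\<in>neighbours G ?v. f u)"
    using neighbours_subset[of ?v]
    by (intro sum.mono_neutral_cong_right) (auto simp: neighbours_def)
  finally show ?thesis .
qed

text \<open>Reading eigenvectors as functions on vertices frees the later arguments from indices
  into \<open>vs\<close>.\<close>

lemma eigenvalue_signless_laplacian_iff:
  assumes vs: "distinct vs" "set vs = verts G"
  shows "eigenvalue (signless_laplacian vs G) k \<longleftrightarrow>
    (\<exists>f. (\<exists>v\<in>verts G. f v \<noteq> 0) \<and>
      (\<forall>v\<in>verts G. real (out_degree G v) * f v + (\<Sum>u\<in>neighbours G v. f u) = k * f v))"
    (is "?L \<longleftrightarrow> (\<exists>f. ?R f)")
proof -
  let ?N = "length vs" and ?Q = "signless_laplacian vs G"
  have dim: "dim_row ?Q = ?N" using signless_laplacian_carrier by auto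
  have ev: "eigenvector ?Q (vec ?N (\<lambda>j. f (vs ! j))) k \<longleftrightarrow> ?R f" for f
  proof -
    have "vec ?N (\<lambda>j. f (vs ! j)) \<noteq> 0\<^sub>v ?N \<longleftrightarrow> (\<exists>v\<in>verts G. f v \<noteq> 0)"
      unfolding vs(2)[symmetric] by (simp add: vec_eq_iff Bex_def in_set_conv_nth) blast
    moreover have "?Q *\<^sub>v vec ?N (\<lambda>j. f (vs ! j)) = k \<cdot>\<^sub>v vec ?N (\<lambda>j. f (vs ! j)) \<longleftrightarrow>
      (\<forall>v\<in>verts G. real (out_degree G v) * f v + (\<Sum>u\<in>neighbours G v. f u) = k * f v)"
      unfolding vs(2)[symmetric]
      by (subst vec_eq_iff)
        (simp add: dim all_set_conv_all_nth signless_laplacian_mult_vec[OF vs] del: index_mult_mat_vec)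
    ultimately show ?thesis unfolding eigenvector_def dim by simp
  qed
  have "\<exists>f. w = vec ?N (\<lambda>j. f (vs ! j))" if "w \<in> carrier_vec ?N" for w :: "real vec"
  proof
    \<comment> \<open>Since \<open>vs\<close> is distinct, inverting the enumeration turns any
      vector into a vertex function.\<close>
    have "the_inv_into {..<?N} ((!) vs) (vs ! j) = j" if "j < ?N" for j
      using that vs(1) by (intro the_inv_into_f_f) (auto simp: inj_on_nth)
    then show "w = vec ?N (\<lambda>j. (\<lambda>u. w $ the_inv_into {..<?N} ((!) vs) u) (vs ! j))"
      using that by auto
  qed
  then have "eigenvalue ?Q k \<longleftrightarrow> (\<exists>f. eigenvector ?Q (vec ?N (\<lambda>j. f (vs ! j))) k)"
    unfolding eigenvalue_def eigenvector_def dim by blast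
  then show ?thesis by (simp only: ev)
qed

lemma signless_laplacian_spectrum:
  assumes "length vs > 0"
  shows "finite (spectrum (signless_laplacian vs G))" "spectrum (signless_laplacian vs G) \<noteq> {}"
proof -
  note Q = signless_laplacian_carrier[of vs]
  show "finite (spectrum (signless_laplacian vs G))" by (rule card_finite_spectrum[OF Q])
  show "spectrum (signless_laplacian vs G) \<noteq> {}"
  proof (rule symmetric_mat_spectrum_nonempty[OF Q assms])
    fix i j assume "i < length vs" "j < length vs"
    then show "signless_laplacian vs G $$ (i, j) = signless_laplacian vs G $$ (j, i)"
      unfolding signless_laplacian_def degree_mat_def adjacency_mat_def mat_diag_def
      using graph_symmetric by auto
  qed
qed

section \<open>The upper bound on the largest eigenvalue\<close>

text \<open>This is the row-sum bound for the signless Laplacian conjugated by the diagonal degree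
  matrix, which is invertible as all degrees are positive. The function \<open>g\<close> is the
  absolute value of the rescaled eigenvector.\<close>

lemma eigenvalue_le_degree_plus_average:
  assumes vs: "distinct vs" "set vs = verts G"
    and pos: "\<And>v. v \<in> verts G \<Longrightarrow> out_degree G v > 0"
    and ev: "eigenvalue (signless_laplacian vs G) q"
  obtains v where "v \<in> verts G"
    "q * real (out_degree G v) \<le> (real (out_degree G v))\<^sup>2 + (\<Sum>u\<in>neighbours G v. real (out_degree G u))"
proof -
  let ?d = "\<lambda>v. real (out_degree G v)"
  obtain f where nz: "\<exists>v\<in>verts G. f v \<noteq> 0"
    and eq: "\<And>v. v \<in> verts G \<Longrightarrow> ?d v * f v + (\<Sum>u\<in>neighbours G v. f u) = q * f v"
    using ev unfolding eigenvalue_signless_laplacian_iff[OF vs] by blast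
  define g where "g v = \<bar>f v\<bar> / ?d v" for v
  have "Max (g ` verts G) \<in> g ` verts G" using nz by (intro Max_in) auto
  then obtain v where v: "v \<in> verts G" and "g v = Max (g ` verts G)" by auto
  then have max: "g u \<le> g v" if "u \<in> verts G" for u using that by simp
  have f: "\<bar>f u\<bar> = g u * ?d u" if "u \<in> verts G" for u
    using pos[OF that] unfolding g_def by simp
  \<comment> \<open>Positivity allows the factor \<open>g v\<close> to be cancelled at the
    end.\<close>
  have gpos: "g v > 0"
  proof -
    obtain u where u: "u \<in> verts G" "f u \<noteq> 0" using nz by auto
    then have "g u > 0" using pos unfolding g_def by simp
    then show ?thesis using max[OF u(1)] by simp
  qed
  have "q * \<bar>f v\<bar> \<le> \<bar>q * f v\<bar>" by (simp add: abs_mult mult_right_mono)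
  also have "\<dots> \<le> \<bar>?d v * f v\<bar> + \<bar>\<Sum>u\<in>neighbours G v. f u\<bar>"
    unfolding eq[OF v, symmetric] by (rule abs_triangle_ineq)
  also have "\<bar>\<Sum>u\<in>neighbours G v. f u\<bar> \<le> (\<Sum>u\<in>neighbours G v. g v * ?d u)"
  proof (rule order_trans[OF sum_abs sum_mono])
    fix u assume "u \<in> neighbours G v"
    then have u: "u \<in> verts G" using neighbours_subset by auto
    show "\<bar>f u\<bar> \<le> g v * ?d u" unfolding f[OF u] by (intro mult_right_mono max u) simp
  qed
  finally have "g v * (q * ?d v) \<le> g v * ((?d v)\<^sup>2 + (\<Sum>u\<in>neighbours G v. ?d u))"
    by (simp add: abs_mult f[OF v] sum_distrib_left power2_eq_square algebra_simps)
  then have "q * ?d v \<le> (?d v)\<^sup>2 + (\<Sum>u\<in>neighbours G v. ?d u)"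
    using gpos by simp
  with v show thesis by (rule that)
qed

lemma connected_sl_index_le:
  assumes vs: "distinct vs" "set vs = verts G"
    and conn: "connected G" and n: "card (verts G) \<ge> 2"
  shows "sl_index vs G * (real (card (verts G)) - 1) \<le> real (num_edges G) * real (card (verts G))"
proof -
  let ?d = "\<lambda>v. real (out_degree G v)"
  define q where "q = sl_index vs G"
  define N where "N = real (card (verts G)) - 1"
  \<comment> \<open>The excess of edges over a spanning tree; the target \<open>m * n\<close>
    becomes \<open>(N + k) * (N + 1)\<close>.\<close>
  define k where "k = real (num_edges G) - N"
  have len: "length vs > 0" using vs n distinct_card by fastforce
  have "q \<in> spectrum (signless_laplacian vs G)"
    unfolding q_def sl_index_def largest_eigenvalue_def
    using signless_laplacian_spectrum[OF len] by (rule Max_in)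
  then have ev: "eigenvalue (signless_laplacian vs G) q" unfolding spectrum_def by simp
  obtain v where v: "v \<in> verts G"
    and le: "q * ?d v \<le> (?d v)\<^sup>2 + (\<Sum>u\<in>neighbours G v. ?d u)"
    using eigenvalue_le_degree_plus_average[OF vs connected_out_degree_pos[OF conn n] ev] .
  define d where "d = ?d v"
  have N: "N \<ge> 1" using n unfolding N_def by simp
  have k: "k \<ge> 0" using connected_num_edges_ge[OF conn] unfolding k_def N_def by linarith
  have dN: "d \<le> N" using out_degree_less[OF v] unfolding d_def N_def by linarith
  have "q * N \<le> (N + k) * (N + 1)"
  \<comment> \<open>Degree 1 is separate because the coefficient \<open>(d - 2) * N + d\<close> of
    \<open>k\<close> in the identity used for the other case can then be negative. Bounding the
    degree of the only neighbour by \<open>N\<close> suffices instead.\<close>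
  proof (cases "out_degree G v = 1")
    case True
    have "(\<Sum>u\<in>neighbours G v. ?d u) \<le> (\<Sum>u\<in>neighbours G v. N)"
    proof (rule sum_mono)
      fix u assume "u \<in> neighbours G v"
      then have "u \<in> verts G" using neighbours_subset by auto
      from out_degree_less[OF this] show "?d u \<le> N" unfolding N_def by linarith
    qed
    then have "q \<le> N + 1"
      using le True out_degree_eq_card_neighbours[of v] by simp
    then have "q * N \<le> (N + 1) * N" using N by (intro mult_right_mono) auto
    also have "\<dots> \<le> (N + k) * (N + 1)" using N k by (simp add: algebra_simps)
    finally show ?thesis .
  next
    case False
    then have d2: "d \<ge> 2" using connected_out_degree_pos[OF conn n v] unfolding d_def by simp
    define s where "s = (\<Sum>u\<in>neighbours G v. out_degree G u)"
    have "real s \<le> N + 2 * k"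
      using connected_sum_neighbour_degrees_le[OF conn n v, folded s_def,
          THEN of_nat_mono[where 'a = real]]
      unfolding N_def k_def by simp
    then have "q * d \<le> d\<^sup>2 + N + 2 * k" using le unfolding d_def s_def by simp
    then have "d * (q * N) \<le> (d\<^sup>2 + N + 2 * k) * N"
      using N mult_right_mono[of "q * d" _ N] by (simp add: ac_simps)
    also have "\<dots> \<le> d * ((N + k) * (N + 1))"
    proof -
      \<comment> \<open>The difference is arranged so that every term is visibly nonnegative for
        \<open>2 \<le> d \<le> N\<close> and \<open>k \<ge> 0\<close>.\<close>
      have "d * ((N + k) * (N + 1)) - (d\<^sup>2 + N + 2 * k) * N =
          N * ((d - 1) * (N - d)) + k * ((d - 2) * N + d)"
        by (simp add: power2_eq_square algebra_simps)
      moreover have "\<dots> \<ge> 0" using N k d2 dN by simp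
      ultimately show ?thesis by linarith
    qed
    finally show ?thesis using d2 by simp
  qed
  then show ?thesis unfolding q_def k_def N_def by simp
qed

text \<open>The bound \<open>q * (n - 1) \<le> m * n\<close> is multiplied by \<open>n\<close> and
  divided by \<open>4 * m * (n - 1)\<close>, where \<open>m > 0\<close> by connectedness.\<close>

lemma connected_irregularity_le:
  assumes vs: "distinct vs" "set vs = verts G"
    and conn: "connected G" and n: "card (verts G) \<ge> 2"
  shows "irregularity vs G \<le> (real (card (verts G)))\<^sup>2 / (4 * (real (card (verts G)) - 1))"
proof -
  define n' where "n' = real (card (verts G))"
  have n': "n' > 1" using n unfolding n'_def by simp
  have m: "real (num_edges G) > 0" using connected_num_edges_ge[OF conn] n by simp
  have "sl_index vs G * (n' - 1) * n' \<le> real (num_edges G) * n' * n'"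
    using connected_sl_index_le[OF assms] n' unfolding n'_def by (intro mult_right_mono) auto
  then show ?thesis
    using n' m unfolding irregularity_def n'_def[symmetric]
    by (simp add: field_simps power2_eq_square)
qed

end

section \<open>Stars attain the bound\<close>

lemma star_connected_sl_index:
  fixes G :: "('a, 'b) pre_digraph"
  assumes star: "complete_bipartite_digraph 1 (n - 1) G"
    and n: "n = card (verts G)" "n \<ge> 2"
    and vs: "distinct vs" "set vs = verts G"
  shows "Digraph_Component.connected G" "num_edges G = n - 1" "sl_index vs G = real n"
proof -
  interpret graph G using star unfolding complete_bipartite_digraph_def by simp
  obtain U L where UL: "verts G = U \<union> L" "U \<inter> L = {}" "card U = 1" "card L = n - 1"
    "arcs_ends G = U \<times> L \<union> L \<times> U"
    using star unfolding complete_bipartite_digraph_def by blast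
  then obtain c where c: "U = {c}" using card_1_singletonE by blast
  have V: "verts G = insert c L" and cL: "c \<notin> L" and E: "arcs_ends G = {c} \<times> L \<union> L \<times> {c}"
    using UL c by auto
  have finL: "finite L" using finite_verts V by simp
  \<comment> \<open>Any two vertices are joined through the centre \<open>c\<close>.\<close>
  have "a \<rightarrow>\<^sup>*\<^bsub>G\<^esub> c" "c \<rightarrow>\<^sup>*\<^bsub>G\<^esub> a" if "a \<in> verts G" for a
    using that V E by (auto intro: reachable_adjI)
  then have "strongly_connected G" using V by (intro strongly_connectedI) (auto intro: reachable_trans)
  then show conn: "connected G"
    using V by (auto simp: strongly_connected_def intro!: connectedI reachable_mk_symmetricI)
  have "card (arcs_ends G) = 2 * (n - 1)"
    unfolding E using cL finL UL(4)
    by (subst card_Un_disjoint) (auto simp: card_cartesian_product)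
  then show m: "num_edges G = n - 1" using card_arcs_ends by simp
  have nbr: "neighbours G v = (if v = c then L else {c})" if "v \<in> verts G" for v
    using that V cL unfolding neighbours_def E by auto
  have "eigenvalue (signless_laplacian vs G) (real n)"
    unfolding eigenvalue_signless_laplacian_iff[OF vs]
  proof (intro exI conjI ballI)
    \<comment> \<open>At the centre the equation reads
      \<open>(n - 1) * (n - 1) + (n - 1) = n * (n - 1)\<close>, and at a leaf
      \<open>1 + (n - 1) = n\<close>.\<close>
    let ?f = "\<lambda>v. if v = c then real n - 1 else 1"
    show "\<exists>v\<in>verts G. ?f v \<noteq> 0" using V n by auto
    fix v assume v: "v \<in> verts G"
    have "(\<Sum>u\<in>L. ?f u) = (\<Sum>u\<in>L. 1)" using cL by (intro sum.cong) auto
    then show "real (out_degree G v) * ?f v + (\<Sum>u\<in>neighbours G v. ?f u) = real n * ?f v"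
      using n UL(4) unfolding out_degree_eq_card_neighbours nbr[OF v]
      by (auto simp: of_nat_diff algebra_simps)
  qed
  then have "real n \<in> spectrum (signless_laplacian vs G)" unfolding spectrum_def by simp
  moreover have "length vs > 0" using vs V by auto
  ultimately have "real n \<le> sl_index vs G"
    unfolding sl_index_def largest_eigenvalue_def
    using signless_laplacian_spectrum(1) by (intro Max_ge)
  \<comment> \<open>With \<open>m = n - 1\<close> the general bound has the positive factor
    \<open>n - 1\<close> on both sides.\<close>
  moreover have "sl_index vs G * (real n - 1) \<le> real n * (real n - 1)"
    using connected_sl_index_le[OF vs conn] m n by (simp add: of_nat_diff mult.commute)
  then have "sl_index vs G \<le> real n" using n(2) by simp
  ultimately show "sl_index vs G = real n" by simp
qed

theorem theorem7:
  fixes G :: "('a, 'b) pre_digraph" and vs :: "'a list" and n :: nat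
  assumes "graph G"
    and "n = card (verts G)" and "n \<ge> 2"
    and "distinct vs" and "set vs = verts G"
  shows "(Digraph_Component.connected G \<longrightarrow>
            irregularity vs G \<le> (real n)\<^sup>2 / (4 * (real n - 1))) \<and>
         (complete_bipartite_digraph 1 (n - 1) G \<longrightarrow>
            Digraph_Component.connected G \<and>
            sl_index vs G = real n \<and>
            irregularity vs G = (real n)\<^sup>2 / (4 * (real n - 1)))"
proof (intro conjI impI)
  interpret graph G by fact
  note vs = \<open>distinct vs\<close> \<open>set vs = verts G\<close>
  show "irregularity vs G \<le> (real n)\<^sup>2 / (4 * (real n - 1))"
    if "Digraph_Component.connected G"
    using connected_irregularity_le[OF vs that] assms(2,3) by simp
  assume star: "complete_bipartite_digraph 1 (n - 1) G"
  note facts = star_connected_sl_index[OF star assms(2,3) vs]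
  show "Digraph_Component.connected G" by (rule facts(1))
  show "sl_index vs G = real n" by (rule facts(3))
  then show "irregularity vs G = (real n)\<^sup>2 / (4 * (real n - 1))"
    using facts(2) assms(2,3) unfolding irregularity_def
    by (simp add: of_nat_diff power2_eq_square)
qed

end
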